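(* Let $n\ge1$ be an integer. (1) Let $1\le p_2<p_1<\infty$. If $0\le\lambda<n$ and $\frac{(n-\lambda)p_2}{p_1}<\alpha<n$, then $wL^{p_1,\lambda}\subseteq S_{p_2,\alpha}$. (2) Conversely, let $1\le p<\infty$ and $0<\alpha<n$. If $f\in S_{p,\alpha}$ and there are constants $\sigma>0$ and $c>0$ such that $\eta_{p,\alpha}f(r)\le c\,r^{\sigma/p}$ for every $r>0$, then $f\in wL^{p,\,n-\alpha+\sigma}$.
   Context: Let $B(x,r):=\{y\in\mathbb{R}^n:|x-y|<r\}$ and let $|E|$ denote Lebesgue measure. For $1\le p<\infty$ and a real number $\lambda\ge0$, the weak Morrey space $wL^{p,\lambda}=wL^{p,\lambda}(\mathbb{R}^n)$ is the set of all Lebesgue measurable functions $f$ on $\mathbb{R}^n$ with $$\|f\|_{wL^{p,\lambda}}:=\sup_{x\in\mathbb{R}^n,\,r>0}r^{-\lambda/p}\,\sup_{t>0}t\,|\{y\in B(x,r):|f(y)|>t\}|^{1/p}<\infty.$$ For $1\le p<\infty$, $0<\alpha<n$ and $f\in L^p_{\rm loc}(\mathbb{R}^n)$, put $$\eta_{p,\alpha}f(r):=\sup_{x\in\mathbb{R}^n}\left(\int_{|x-y|<r}\frac{|f(y)|^p}{|x-y|^{n-\alpha}}\,dy\right)^{1/p}\in[0,\infty],\quad r>0,$$ which is nondecreasing in $r$, and $S_{p,\alpha}=S_{p,\alpha}(\mathbb{R}^n):=\{f\in L^p_{\rm loc}(\mathbb{R}^n):\ \eta_{p,\alpha}f(r)\searrow0\text{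 as }r\searrow0\}$, i.e. $\lim_{r\to0^+}\eta_{p,\alpha}f(r)=0$. *)

theory Defs
  imports "HOL-Analysis.Analysis"
begin

text \<open>Real powers of extended nonnegative reals, used for positive exponents only
  (so that infinity to the power \<open>a\<close> is infinity).\<close>

definition ennpowr :: "ennreal \<Rightarrow> real \<Rightarrow> ennreal" where
  "ennpowr x a = (if x = \<infinity> then \<infinity> else ennreal (enn2real x powr a))"

definition weak_morrey_norm :: "real \<Rightarrow> real \<Rightarrow> (real ^ 'n \<Rightarrow> real) \<Rightarrow> ennreal" where
  "weak_morrey_norm p lam f =
     (SUP x. SUP r\<in>{0<..}. ennreal (r powr (- (lam / p))) *
       (SUP t\<in>{0<..}. ennreal t *
          ennpowr (emeasure lebesgue {y \<in> ball x r. \<bar>f y\<bar> > t}) (1 / p)))"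

definition weak_morrey :: "real \<Rightarrow> real \<Rightarrow> (real ^ 'n \<Rightarrow> real) set" where
  "weak_morrey p lam = {f \<in> borel_measurable lebesgue. weak_morrey_norm p lam f < \<infinity>}"

definition Lp_loc :: "real \<Rightarrow> (real ^ 'n \<Rightarrow> real) set" where
  "Lp_loc p = {f \<in> borel_measurable lebesgue.
     \<forall>K. compact K \<longrightarrow> set_integrable lebesgue K (\<lambda>y. \<bar>f y\<bar> powr p)}"

text \<open>At \<open>y = x\<close> the integrand below is 0, by the convention for division by zero;
  a single point is Lebesgue null, so this does not affect the integral.\<close>

definition stummel_modulus :: "real \<Rightarrow> real \<Rightarrow> (real ^ 'n \<Rightarrow> real) \<Rightarrow> real \<Rightarrow> ennreal" where
  "stummel_modulus p \<alpha> f r =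
     (SUP x. ennpowr
        (\<integral>\<^sup>+ y\<in>ball x r.
           ennreal (\<bar>f y\<bar> powr p / norm (x - y) powr (real CARD('n) - \<alpha>)) \<partial>lebesgue) (1 / p))"

definition stummel :: "real \<Rightarrow> real \<Rightarrow> (real ^ 'n \<Rightarrow> real) set" where
  "stummel p \<alpha> = {f \<in> Lp_loc p. (stummel_modulus p \<alpha> f \<longlongrightarrow> 0) (at_right 0)}"

end

theory Submission
  imports Defs
begin

text \<open>
  The inclusion rests on one dyadic estimate: if the integral of \<open>v\<close> over \<open>{u > 2\<^sup>k}\<close> decays like
  \<open>2\<close> to the power \<open>- b k\<close>, then \<open>v u\<^sup>q\<close> is integrable over \<open>{u > 1}\<close> for every \<open>q < b\<close>, because
  \<open>u\<^sup>q\<close> is dominated there by a sum of \<open>2\<close> to the power \<open>q (k + 1)\<close> times the indicators of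
  \<open>{u > 2\<^sup>k}\<close>. With \<open>u = |f| / T\<close> the level set bounds control
  the integral of \<open>|f|\<close> to the power \<open>p2\<close> over balls; these in turn
  are the decay hypothesis for \<open>u = r / |x - y|\<close>, and the second application bounds the Stummel
  modulus by a positive power of \<open>r\<close>. The converse is Chebyshev's inequality, since the kernel is at
  least \<open>r\<close> to the power \<open>\<alpha> - n\<close> on a ball of radius \<open>r\<close>.
\<close>

section \<open>Powers of extended nonnegative reals\<close>

lemma ennpowr_ennreal: "0 \<le> x \<Longrightarrow> ennpowr (ennreal x) a = ennreal (x powr a)"
  by (simp add: ennpowr_def)

lemma ennpowr_mono:
  assumes "x \<le> y" "0 \<le> a"
  shows "ennpowr x a \<le> ennpowr y a"
proof (cases y)
  case (real s)
  then obtain r where "x = ennreal r" "0 \<le> r"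
    using assms(1) by (cases x) (auto simp: top_unique)
  with real assms show ?thesis
    by (auto simp: ennpowr_ennreal intro!: ennreal_leI powr_mono2)
qed (simp add: ennpowr_def)

lemma le_powr_if_ennpowr_le:
  assumes "ennpowr x (1 / p) \<le> ennreal y" "0 \<le> y" "0 < p"
  shows "x \<le> ennreal (y powr p)"
proof (cases x)
  case (real r)
  with assms have "r powr (1 / p) \<le> y"
    by (simp add: ennpowr_ennreal)
  then have "(r powr (1 / p)) powr p \<le> y powr p"
    using assms by (intro powr_mono2) auto
  with real assms show ?thesis
    by (auto simp: powr_powr intro!: ennreal_leI)
next
  \<comment> \<open>\<open>ennpowr\<close> keeps infinity infinite, so the finite bound rules this
    case out.\<close>
  case top
  with assms show ?thesis by (simp add: ennpowr_def top_unique)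
qed

section \<open>Dyadic summation over superlevel sets\<close>

lemma powr_le_dyadic_suminf:
  fixes u q :: real
  assumes "1 < u" "0 \<le> q"
  shows "ennreal (u powr q) \<le> (\<Sum>k. ennreal (2 powr (q * (real k + 1))) * indicator {2 ^ k<..} u)"
proof -
  \<comment> \<open>This is the dyadic index with 2^k < u and u \<le> 2^(k+1). Minimality gives the
    lower bound when k is positive; for k = 0 it is the hypothesis 1 < u.\<close>
  define k where "k = (LEAST n. u \<le> 2 ^ Suc n)"
  obtain n where "u < 2 ^ n"
    using real_arch_pow[of 2 u] by auto
  then have "u \<le> 2 ^ Suc n"
    by (simp add: less_eq_real_def) (use assms in linarith)
  then have upper: "u \<le> 2 ^ Suc k"
    unfolding k_def by (rule LeastI)
  have lower: "2 ^ k < u"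
  proof (cases k)
    case (Suc j)
    then have "\<not> u \<le> 2 ^ Suc j"
      using not_less_Least[of j "\<lambda>n. u \<le> 2 ^ Suc n"] by (simp add: k_def)
    with Suc show ?thesis by simp
  qed (use assms in simp)
  have "u powr q \<le> (2 ^ Suc k) powr q"
    using upper assms by (intro powr_mono2) auto
  also have "(2 ^ Suc k) powr q = (2 powr (q * (real k + 1)) :: real)"
    by (subst powr_realpow[symmetric]) (simp_all add: powr_powr mult.commute add.commute)
  \<comment> \<open>The term of index k alone dominates. Its coefficient comes from the upper end
    2^(k+1) of the dyadic interval, hence the shift k + 1 in the exponent, while its indicator
    records the lower end 2^k.\<close>
  finally have "ennreal (u powr q) \<le>
      (\<Sum>j\<in>{k}. ennreal (2 powr (q * (real j + 1))) * indicator {2 ^ j<..} u)"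
    using lower by (auto intro!: ennreal_leI)
  also have "\<dots> \<le> (\<Sum>k. ennreal (2 powr (q * (real k + 1))) * indicator {2 ^ k<..} u)"
    by (rule sum_le_suminf) auto
  finally show ?thesis .
qed

text \<open>Termwise integration of the dyadic sum turns the tail hypothesis into a geometric series
  of ratio 2^(q - b), which is below 1 because q < b. The weight v is kept arbitrary so that it can
  be the indicator of a ball in one application and a power of |f| in the other.\<close>

lemma nn_integral_powr_dyadic_tail:
  fixes u :: "'a \<Rightarrow> real" and A q b :: real
  assumes [measurable]: "u \<in> borel_measurable M" "v \<in> borel_measurable M"
    and "0 \<le> q" "q < b" "0 \<le> A"
    and tail: "\<And>k. (\<integral>\<^sup>+ y. v y * indicator {2 ^ k<..} (u y) \<partial>M) \<le> ennreal (A * 2 powr (- b * real k))"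
  shows "(\<integral>\<^sup>+ y. v y * (ennreal (u y powr q) * indicator {1<..} (u y)) \<partial>M)
           \<le> ennreal (A * (2 powr q / (1 - 2 powr (q - b))))"
proof -
  have "(2::real) powr (q - b) < 2 powr 0"
    using assms by (intro powr_less_mono) auto
  then have ratio: "norm (2 powr (q - b) :: real) < 1" by simp
  have "(\<integral>\<^sup>+ y. v y * (ennreal (u y powr q) * indicator {1<..} (u y)) \<partial>M)
      \<le> (\<integral>\<^sup>+ y. (\<Sum>k. ennreal (2 powr (q * (real k + 1))) * (v y * indicator {2 ^ k<..} (u y))) \<partial>M)"
  proof (rule nn_integral_mono)
    fix y
    have "v y * (ennreal (u y powr q) * indicator {1<..} (u y))
        \<le> v y * (\<Sum>k. ennreal (2 powr (q * (real k + 1))) * indicator {2 ^ k<..} (u y))"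
      using powr_le_dyadic_suminf[OF _ \<open>0 \<le> q\<close>, of "u y"]
      by (cases "1 < u y") (auto intro!: mult_left_mono)
    also have "\<dots> = (\<Sum>k. v y * (ennreal (2 powr (q * (real k + 1))) * indicator {2 ^ k<..} (u y)))"
      by (rule ennreal_suminf_cmult[symmetric])
    finally show "v y * (ennreal (u y powr q) * indicator {1<..} (u y))
        \<le> (\<Sum>k. ennreal (2 powr (q * (real k + 1))) * (v y * indicator {2 ^ k<..} (u y)))"
      by (simp add: mult_ac)
  qed
  also have "\<dots> = (\<Sum>k. \<integral>\<^sup>+ y. ennreal (2 powr (q * (real k + 1))) * (v y * indicator {2 ^ k<..} (u y)) \<partial>M)"
    by (rule nn_integral_suminf) measurable
  also have "\<dots> = (\<Sum>k. ennreal (2 powr (q * (real k + 1))) * (\<integral>\<^sup>+ y. v y * indicator {2 ^ k<..} (u y) \<partial>M))"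
    by (subst nn_integral_cmult) measurable
  also have "\<dots> \<le> (\<Sum>k. ennreal (2 powr (q * (real k + 1))) * ennreal (A * 2 powr (- b * real k)))"
    using tail by (intro suminf_le mult_left_mono) auto
  also have "\<dots> = (\<Sum>k. ennreal (A * 2 powr q * (2 powr (q - b)) ^ k))"
  proof (rule suminf_cong)
    fix k
    have "2 powr (q * (real k + 1)) * (A * 2 powr (- b * real k)) = A * 2 powr q * 2 powr ((q - b) * real k)"
      by (simp add: powr_add[symmetric] algebra_simps)
    also have "2 powr ((q - b) * real k) = ((2::real) powr (q - b)) ^ k"
      by (simp add: powr_powr[symmetric] powr_realpow)
    finally show "ennreal (2 powr (q * (real k + 1))) * ennreal (A * 2 powr (- b * real k))
        = ennreal (A * 2 powr q * (2 powr (q - b)) ^ k)"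
      using \<open>0 \<le> A\<close> by (subst ennreal_mult[symmetric]) auto
  qed
  also have "\<dots> = ennreal (A * 2 powr q * (1 / (1 - 2 powr (q - b))))"
    using \<open>0 \<le> A\<close> by (intro suminf_ennreal_eq sums_mult geometric_sums ratio) auto
  finally show ?thesis by simp
qed

section \<open>Level sets and local integrals of weak Morrey functions\<close>

lemma weak_morrey_level_set:
  fixes f :: "real ^ 'n \<Rightarrow> real"
  assumes "weak_morrey_norm p lam f \<le> ennreal m" "0 \<le> m" "0 < p" "0 < r" "0 < t"
  shows "emeasure lebesgue {y \<in> ball x r. \<bar>f y\<bar> > t} \<le> ennreal (m powr p * r powr lam * t powr (- p))"
proof -
  let ?E = "emeasure lebesgue {y \<in> ball x r. \<bar>f y\<bar> > t}"
  have "ennreal (r powr (- (lam / p))) * (ennreal t * ennpowr ?E (1 / p)) \<le> weak_morrey_norm p lam f"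
    unfolding weak_morrey_norm_def using assms
    by (intro SUP_upper2[of x] SUP_upper2[of r] mult_left_mono SUP_upper2[of t]) auto
  then have *: "ennreal (r powr (- (lam / p)) * t) * ennpowr ?E (1 / p) \<le> ennreal m"
    using assms by (auto simp: ennreal_mult mult.assoc intro: order_trans)
  \<comment> \<open>The factor \<open>r powr (lam / p) / t\<close> is the inverse of the finite
    positive coefficient in \<open>*\<close>; multiplying by it isolates the power of the measure
    without any division in \<open>ennreal\<close>.\<close>
  have "ennpowr ?E (1 / p) = ennreal (r powr (lam / p) / t) *
      (ennreal (r powr (- (lam / p)) * t) * ennpowr ?E (1 / p))"
    using assms by (simp add: mult.assoc[symmetric] ennreal_mult[symmetric] powr_add[symmetric])
  also have "\<dots> \<le> ennreal (r powr (lam / p) / t) * ennreal m"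
    by (intro mult_left_mono *) auto
  also have "\<dots> = ennreal (r powr (lam / p) / t * m)"
    using assms by (intro ennreal_mult[symmetric]) auto
  finally have "?E \<le> ennreal ((r powr (lam / p) / t * m) powr p)"
    using assms by (intro le_powr_if_ennpowr_le) auto
  also have "(r powr (lam / p) / t * m) powr p = m powr p * r powr lam * t powr (- p)"
    using assms by (simp add: powr_mult powr_divide powr_powr powr_minus_divide)
  finally show ?thesis .
qed

text \<open>The integral is split at a height T depending on r. The values up to T contribute at
  most T^p2 times the volume of the ball, and the larger ones are controlled by the dyadic lemma
  with q = p2 and b = p1. The constant depends on neither the centre nor the radius, which the
  kernel estimate needs, as it uses all the balls of radius r / 2^k.\<close>

lemma weak_morrey_nn_integral_ball:
  fixes f :: "real ^ 'n \<Rightarrow> real"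
  assumes "f \<in> weak_morrey p1 lam" "0 \<le> p2" "p2 < p1"
  obtains C where "0 \<le> C" "\<And>x r. 0 < r \<Longrightarrow>
    (\<integral>\<^sup>+ y\<in>ball x r. ennreal (\<bar>f y\<bar> powr p2) \<partial>lebesgue)
      \<le> ennreal (C * r powr (real CARD('n) - (real CARD('n) - lam) * p2 / p1))"
proof -
  let ?n = "real CARD('n)"
  have [measurable]: "f \<in> borel_measurable lebesgue"
    using assms by (simp add: weak_morrey_def)
  note [measurable] = fmeasurableD[OF lmeasurable_ball]
  obtain m where m: "weak_morrey_norm p1 lam f \<le> ennreal m" "0 \<le> m"
    using assms by (cases "weak_morrey_norm p1 lam f") (auto simp: weak_morrey_def)
  define K where "K = 2 powr p2 / (1 - 2 powr (p2 - p1))"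
  have "(2::real) powr (p2 - p1) < 2 powr 0"
    using assms by (intro powr_less_mono) auto
  then have "0 \<le> K" by (simp add: K_def)
  \<comment> \<open>The first summand accounts for |f| \<le> T through the volume of the ball, the
    second for |f| > T through the geometric constant K.\<close>
  define C where "C = unit_ball_vol ?n + m powr p1 * K"
  have "(\<integral>\<^sup>+ y\<in>ball x r. ennreal (\<bar>f y\<bar> powr p2) \<partial>lebesgue)
      \<le> ennreal (C * r powr (?n - (?n - lam) * p2 / p1))" if "0 < r" for x r
  proof -
    \<comment> \<open>This threshold makes both terms of the estimate the same power of \<open>r\<close>.\<close>
    define T where "T = r powr (- (?n - lam) / p1)"
    have "0 < T" using that by (simp add: T_def)
    \<comment> \<open>The level set bound at height 2^k T carries this product; for the chosen T it
      has the order r^n of the volume of the ball.\<close>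
    have T_p1: "r powr lam * T powr (- p1) = r powr ?n"
      using assms that by (simp add: T_def powr_powr powr_add[symmetric])
    have T_p2: "r powr ?n * T powr p2 = r powr (?n - (?n - lam) * p2 / p1)"
      using assms that by (simp add: T_def powr_powr powr_add[symmetric] algebra_simps add_divide_distrib diff_divide_distrib)
    have large: "(\<integral>\<^sup>+ y. indicator (ball x r) y *
        (ennreal ((\<bar>f y\<bar> / T) powr p2) * indicator {1<..} (\<bar>f y\<bar> / T)) \<partial>lebesgue)
        \<le> ennreal (m powr p1 * r powr ?n * K)"
      unfolding K_def
    proof (rule nn_integral_powr_dyadic_tail)
      fix k :: nat
      have "(\<integral>\<^sup>+ y. indicator (ball x r) y * indicator {2 ^ k<..} (\<bar>f y\<bar> / T) \<partial>lebesgue)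
          = (\<integral>\<^sup>+ y. indicator {y \<in> ball x r. \<bar>f y\<bar> > 2 ^ k * T} y \<partial>lebesgue)"
        using \<open>0 < T\<close> by (intro nn_integral_cong) (auto simp: indicator_def field_simps)
      also have "\<dots> = emeasure lebesgue {y \<in> ball x r. \<bar>f y\<bar> > 2 ^ k * T}"
        by (rule nn_integral_indicator) measurable
      also have "\<dots> \<le> ennreal (m powr p1 * r powr lam * (2 ^ k * T) powr (- p1))"
        using weak_morrey_level_set[OF m] assms that \<open>0 < T\<close> by simp
      also have "(2 ^ k * T) powr (- p1) = T powr (- p1) * 2 powr (- p1 * real k)"
        using \<open>0 < T\<close> by (simp add: powr_mult powr_realpow[symmetric] powr_powr mult_ac)
      finally show "(\<integral>\<^sup>+ y. indicator (ball x r) y * indicator {2 ^ k<..} (\<bar>f y\<bar> / T) \<partial>lebesgue)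
          \<le> ennreal (m powr p1 * r powr ?n * 2 powr (- p1 * real k))"
        by (simp add: T_p1[symmetric] mult.assoc)
    qed (use assms in auto)
    \<comment> \<open>Up to T the first indicator already suffices. Above T the second term
      suffices, since |f|^p2 = T^p2 (|f| / T)^p2; the extra 1 there only enlarges the bound.\<close>
    have "(\<integral>\<^sup>+ y\<in>ball x r. ennreal (\<bar>f y\<bar> powr p2) \<partial>lebesgue)
      \<le> (\<integral>\<^sup>+ y. ennreal (T powr p2) * (indicator (ball x r) y + indicator (ball x r) y *
        (ennreal ((\<bar>f y\<bar> / T) powr p2) * indicator {1<..} (\<bar>f y\<bar> / T))) \<partial>lebesgue)"
    proof (rule nn_integral_mono)
      fix y
      show "ennreal (\<bar>f y\<bar> powr p2) * indicator (ball x r) y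
        \<le> ennreal (T powr p2) * (indicator (ball x r) y + indicator (ball x r) y *
        (ennreal ((\<bar>f y\<bar> / T) powr p2) * indicator {1<..} (\<bar>f y\<bar> / T)))"
      proof (cases "\<bar>f y\<bar> \<le> T")
        case True
        then have "\<bar>f y\<bar> powr p2 \<le> T powr p2"
          using assms by (intro powr_mono2) auto
        then show ?thesis
          using True \<open>0 < T\<close> by (auto simp: indicator_def intro!: ennreal_leI)
      next
        case False
        have "\<bar>f y\<bar> powr p2 \<le> T powr p2 * (1 + (\<bar>f y\<bar> / T) powr p2)"
          using \<open>0 < T\<close> by (simp add: powr_divide field_simps)
        then have "ennreal (\<bar>f y\<bar> powr p2) \<le> ennreal (T powr p2 * (1 + (\<bar>f y\<bar> / T) powr p2))"
          by (rule ennreal_leI)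
        also have "\<dots> = ennreal (T powr p2) * (1 + ennreal ((\<bar>f y\<bar> / T) powr p2))"
          by (simp add: ennreal_mult ennreal_plus)
        finally show ?thesis
          using False \<open>0 < T\<close> by (auto simp: indicator_def field_simps)
      qed
    qed
    also have "\<dots> = ennreal (T powr p2) * (emeasure lebesgue (ball x r) + (\<integral>\<^sup>+ y. indicator (ball x r) y *
        (ennreal ((\<bar>f y\<bar> / T) powr p2) * indicator {1<..} (\<bar>f y\<bar> / T)) \<partial>lebesgue))"
      by (simp add: nn_integral_cmult nn_integral_add)
    also have "\<dots> \<le> ennreal (T powr p2) * (ennreal (unit_ball_vol ?n * r powr ?n) + ennreal (m powr p1 * r powr ?n * K))"
      using that large by (intro mult_left_mono add_mono) (simp_all add: emeasure_ball powr_realpow)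
    also have "\<dots> = ennreal (C * (r powr ?n * T powr p2))"
      using \<open>0 \<le> K\<close> by (simp add: ennreal_plus[symmetric] ennreal_mult[symmetric] C_def algebra_simps del: ennreal_plus)
    finally show ?thesis by (simp add: T_p2)
  qed
  moreover have "0 \<le> C" using \<open>0 \<le> K\<close> by (simp add: C_def)
  ultimately show ?thesis using that by blast
qed

section \<open>From weak Morrey spaces to the Stummel class\<close>

text \<open>With u = r / |x - y| the kernel is r^(\<alpha> - n) u^(n - \<alpha>), and {u > 2^k} is
  the ball of radius r / 2^k without its centre. The integral bound on these balls is the tail
  hypothesis of the dyadic lemma with b = n - \<beta> and q = n - \<alpha>, so q < b is exactly the
  assumption \<beta> < \<alpha>.\<close>

lemma weak_morrey_stummel_modulus:
  fixes f :: "real ^ 'n \<Rightarrow> real"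
  assumes f: "f \<in> weak_morrey p1 lam" and "1 \<le> p2" "p2 < p1"
    and \<alpha>: "(real CARD('n) - lam) * p2 / p1 < \<alpha>" "\<alpha> < real CARD('n)"
  obtains C where "\<And>r. 0 < r \<Longrightarrow> stummel_modulus p2 \<alpha> f r
      \<le> ennreal ((C * r powr (\<alpha> - (real CARD('n) - lam) * p2 / p1)) powr (1 / p2))"
proof -
  let ?n = "real CARD('n)"
  have [measurable]: "f \<in> borel_measurable lebesgue"
    using f by (simp add: weak_morrey_def)
  define \<beta> where "\<beta> = (?n - lam) * p2 / p1"
  obtain C where C: "0 \<le> C" "\<And>x r. 0 < r \<Longrightarrow>
    (\<integral>\<^sup>+ y\<in>ball x r. ennreal (\<bar>f y\<bar> powr p2) \<partial>lebesgue) \<le> ennreal (C * r powr (?n - \<beta>))"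
    using weak_morrey_nn_integral_ball[OF f, of p2] assms by (auto simp: \<beta>_def)
  define K where "K = 2 powr (?n - \<alpha>) / (1 - 2 powr ((?n - \<alpha>) - (?n - \<beta>)))"
  have "(2::real) powr ((?n - \<alpha>) - (?n - \<beta>)) < 2 powr 0"
    using \<alpha> by (intro powr_less_mono) (auto simp: \<beta>_def)
  then have "0 \<le> K" by (simp add: K_def)
  have "(\<integral>\<^sup>+ y\<in>ball x r. ennreal (\<bar>f y\<bar> powr p2 / norm (x - y) powr (?n - \<alpha>)) \<partial>lebesgue)
      \<le> ennreal (C * K * r powr (\<alpha> - \<beta>))" if "0 < r" for x r
  proof -
    let ?u = "\<lambda>y. r / norm (x - y)"
    have "?u \<in> borel_measurable borel" by measurable
    then have [measurable]: "?u \<in> borel_measurable lebesgue"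
      by (intro measurable_completion) simp
    \<comment> \<open>Division by zero gives u the value 0 at y = x, so the centre lies in no
      superlevel set of positive height.\<close>
    have u_greater: "s < ?u y \<longleftrightarrow> y \<in> ball x (r / s) \<and> y \<noteq> x" if "0 < s" for s y
      using that \<open>0 < r\<close> by (cases "y = x") (auto simp: dist_norm field_simps)
    have "(\<integral>\<^sup>+ y\<in>ball x r. ennreal (\<bar>f y\<bar> powr p2 / norm (x - y) powr (?n - \<alpha>)) \<partial>lebesgue)
      = (\<integral>\<^sup>+ y. ennreal (r powr (- (?n - \<alpha>))) * (ennreal (\<bar>f y\<bar> powr p2) *
          (ennreal (?u y powr (?n - \<alpha>)) * indicator {1<..} (?u y))) \<partial>lebesgue)"
    proof (rule nn_integral_cong)
      fix y
      \<comment> \<open>This holds at y = x too, where both sides are 0, so the two integrands agree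
        everywhere and no almost-everywhere argument is required.\<close>
      have "\<bar>f y\<bar> powr p2 / norm (x - y) powr (?n - \<alpha>)
          = r powr (- (?n - \<alpha>)) * (\<bar>f y\<bar> powr p2 * ?u y powr (?n - \<alpha>))"
        using that unfolding powr_minus by (simp add: powr_divide)
      then show "ennreal (\<bar>f y\<bar> powr p2 / norm (x - y) powr (?n - \<alpha>)) * indicator (ball x r) y
        = ennreal (r powr (- (?n - \<alpha>))) * (ennreal (\<bar>f y\<bar> powr p2) *
          (ennreal (?u y powr (?n - \<alpha>)) * indicator {1<..} (?u y)))"
        using u_greater[of 1 y] by (auto simp: indicator_def ennreal_mult)
    qed
    also have "\<dots> = ennreal (r powr (- (?n - \<alpha>))) * (\<integral>\<^sup>+ y. ennreal (\<bar>f y\<bar> powr p2) *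
          (ennreal (?u y powr (?n - \<alpha>)) * indicator {1<..} (?u y)) \<partial>lebesgue)"
      by (rule nn_integral_cmult) measurable
    also have "\<dots> \<le> ennreal (r powr (- (?n - \<alpha>))) * ennreal (C * r powr (?n - \<beta>) * K)"
      unfolding K_def
    proof (intro mult_left_mono nn_integral_powr_dyadic_tail)
      fix k :: nat
      have "(\<integral>\<^sup>+ y. ennreal (\<bar>f y\<bar> powr p2) * indicator {2 ^ k<..} (?u y) \<partial>lebesgue)
          \<le> (\<integral>\<^sup>+ y\<in>ball x (r / 2 ^ k). ennreal (\<bar>f y\<bar> powr p2) \<partial>lebesgue)"
        using u_greater[of "2 ^ k"] by (intro nn_integral_mono) (auto simp: indicator_def)
      also have "\<dots> \<le> ennreal (C * (r / 2 ^ k) powr (?n - \<beta>))"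
        using that by (intro C) auto
      also have "(r / 2 ^ k) powr (?n - \<beta>) = r powr (?n - \<beta>) * 2 powr (- (?n - \<beta>) * real k)"
        using that
        by (simp add: powr_divide powr_realpow[symmetric] powr_powr divide_powr_uminus powr_mult algebra_simps)
      finally show "(\<integral>\<^sup>+ y. ennreal (\<bar>f y\<bar> powr p2) * indicator {2 ^ k<..} (?u y) \<partial>lebesgue)
          \<le> ennreal (C * r powr (?n - \<beta>) * 2 powr (- (?n - \<beta>) * real k))"
        by (simp add: mult.assoc)
    qed (use \<alpha> C in \<open>auto simp: \<beta>_def\<close>)
    also have "\<dots> = ennreal (C * K * (r powr (- (?n - \<alpha>)) * r powr (?n - \<beta>)))"
      using C \<open>0 \<le> K\<close> by (simp add: ennreal_mult[symmetric] mult_ac)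
    also have "r powr (- (?n - \<alpha>)) * r powr (?n - \<beta>) = r powr (\<alpha> - \<beta>)"
      by (simp add: powr_add[symmetric])
    finally show ?thesis .
  qed
  \<comment> \<open>The bound is uniform in x, so it survives the supremum.\<close>
  then have "stummel_modulus p2 \<alpha> f r \<le> ennreal ((C * K * r powr (\<alpha> - \<beta>)) powr (1 / p2))"
    if "0 < r" for r
    unfolding stummel_modulus_def
    using that assms C \<open>0 \<le> K\<close> ennpowr_mono[of _ "ennreal (C * K * r powr (\<alpha> - \<beta>))" "1 / p2"]
    by (auto intro!: SUP_least simp: ennpowr_ennreal)
  then show ?thesis using that unfolding \<beta>_def by blast
qed

lemma weak_morrey_subset_Lp_loc:
  assumes "0 \<le> p2" "p2 < p1"
  shows "weak_morrey p1 lam \<subseteq> (Lp_loc p2 :: (real ^ 'n \<Rightarrow> real) set)"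
proof
  fix f :: "real ^ 'n \<Rightarrow> real"
  assume f: "f \<in> weak_morrey p1 lam"
  then have [measurable]: "f \<in> borel_measurable lebesgue"
    by (simp add: weak_morrey_def)
  obtain C where "0 \<le> C" and C: "\<And>x r. 0 < r \<Longrightarrow>
    (\<integral>\<^sup>+ y\<in>ball x r. ennreal (\<bar>f y\<bar> powr p2) \<partial>lebesgue)
      \<le> ennreal (C * r powr (real CARD('n) - (real CARD('n) - lam) * p2 / p1))"
    by (rule weak_morrey_nn_integral_ball[OF f assms]) blast
  have "set_integrable lebesgue K (\<lambda>y. \<bar>f y\<bar> powr p2)" if "compact K" for K
    unfolding set_integrable_def
  proof (rule integrableI_bounded)
    have [measurable]: "K \<in> sets lebesgue" using that by (simp add: compact_imp_closed)
    show "(\<lambda>y. indicat_real K y *\<^sub>R \<bar>f y\<bar> powr p2) \<in> borel_measurable lebesgue" by measurable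
    \<comment> \<open>Local integrability reduces to one ball around the origin, where the integral
      estimate gives a finite value.\<close>
    obtain R where "0 < R" "K \<subseteq> ball 0 R"
      using bounded_subset_ballD[OF compact_imp_bounded[OF \<open>compact K\<close>], of 0] by blast
    then have "(\<integral>\<^sup>+ y. ennreal (norm (indicat_real K y *\<^sub>R \<bar>f y\<bar> powr p2)) \<partial>lebesgue)
        \<le> (\<integral>\<^sup>+ y\<in>ball 0 R. ennreal (\<bar>f y\<bar> powr p2) \<partial>lebesgue)"
      by (intro nn_integral_mono) (auto simp: indicator_def)
    also have "\<dots> < \<infinity>"
      using C[OF \<open>0 < R\<close>, of 0] by (simp add: le_less_trans)
    finally show "(\<integral>\<^sup>+ y. ennreal (norm (indicat_real K y *\<^sub>R \<bar>f y\<bar> powr p2)) \<partial>lebesgue) < \<infinity>" .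
  qed
  then show "f \<in> Lp_loc p2"
    by (simp add: Lp_loc_def)
qed

lemma weak_morrey_subset_stummel:
  assumes "1 \<le> p2" "p2 < p1"
    and "(real CARD('n) - lam) * p2 / p1 < \<alpha>" "\<alpha> < real CARD('n)"
  shows "weak_morrey p1 lam \<subseteq> (stummel p2 \<alpha> :: (real ^ 'n \<Rightarrow> real) set)"
proof
  fix f :: "real ^ 'n \<Rightarrow> real"
  assume f: "f \<in> weak_morrey p1 lam"
  \<comment> \<open>The gap in the hypothesis on \<alpha> is the power of r gained in the modulus;
    its positivity forces the limit 0.\<close>
  define \<delta> where "\<delta> = \<alpha> - (real CARD('n) - lam) * p2 / p1"
  have "0 < \<delta>" using assms by (simp add: \<delta>_def)
  obtain C where C: "\<And>r. 0 < r \<Longrightarrow> stummel_modulus p2 \<alpha> f r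
      \<le> ennreal ((C * r powr \<delta>) powr (1 / p2))"
    using weak_morrey_stummel_modulus[OF f assms] by (auto simp: \<delta>_def)
  have "((\<lambda>r. r powr \<delta>) \<longlongrightarrow> 0) (at_right 0)"
    using \<open>0 < \<delta>\<close> by (intro tendsto_zero_powrI[where b = \<delta>] tendsto_const)
      (auto simp: eventually_at_filter intro: tendsto_ident_at)
  then have "((\<lambda>r. C powr (1 / p2) * (r powr \<delta>) powr (1 / p2)) \<longlongrightarrow> 0) (at_right 0)"
    using assms by (intro tendsto_mult_right_zero
      tendsto_zero_powrI[of "\<lambda>r. r powr \<delta>", OF _ tendsto_const]) auto
  then have "((\<lambda>r. ennreal ((C * r powr \<delta>) powr (1 / p2))) \<longlongrightarrow> ennreal 0) (at_right 0)"
    by (intro tendsto_ennrealI) (simp add: powr_mult)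
  then have lim: "((\<lambda>r. ennreal ((C * r powr \<delta>) powr (1 / p2))) \<longlongrightarrow> 0) (at_right 0)"
    by (simp only: ennreal_0)
  have "\<forall>\<^sub>F r in at_right 0. 0 \<le> stummel_modulus p2 \<alpha> f r"
    by simp
  moreover have "\<forall>\<^sub>F r in at_right 0. stummel_modulus p2 \<alpha> f r \<le> ennreal ((C * r powr \<delta>) powr (1 / p2))"
    using C by (rule eventually_mono[OF eventually_at_right_less])
  ultimately have "(stummel_modulus p2 \<alpha> f \<longlongrightarrow> 0) (at_right 0)"
    by (rule tendsto_sandwich[OF _ _ tendsto_const lim])
  moreover have "f \<in> Lp_loc p2"
    using weak_morrey_subset_Lp_loc[of p2 p1 lam] f assms by auto
  ultimately show "f \<in> stummel p2 \<alpha>"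
    by (simp add: stummel_def)
qed

section \<open>From a decaying Stummel modulus to a weak Morrey bound\<close>

lemma stummel_level_set:
  fixes f :: "real ^ 'n \<Rightarrow> real"
  assumes [measurable]: "f \<in> borel_measurable lebesgue"
    and "0 < p" "\<alpha> < real CARD('n)" "0 < r" "0 < t" "0 \<le> s"
    and le: "stummel_modulus p \<alpha> f r \<le> ennreal s"
  shows "emeasure lebesgue {y \<in> ball x r. \<bar>f y\<bar> > t}
           \<le> ennreal (r powr (real CARD('n) - \<alpha>) * (s / t) powr p)"
proof -
  note [measurable] = fmeasurableD[OF lmeasurable_ball]
  let ?n = "real CARD('n)" and ?E = "{y \<in> ball x r. \<bar>f y\<bar> > t}"
  let ?w = "\<lambda>y. ennreal (\<bar>f y\<bar> powr p / norm (x - y) powr (?n - \<alpha>)) * indicator (ball x r) y"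
  \<comment> \<open>The comparison can fail at y = x: there the integrand is 0 by convention, while
    x may belong to the level set.\<close>
  have "AE y in lebesgue. y \<noteq> x"
    by (rule AE_I[of _ _ "{x}"]) auto
  then have "AE y in lebesgue. indicator ?E y \<le> ennreal (r powr (?n - \<alpha>) * t powr (- p)) * ?w y"
  proof (rule eventually_mono)
    fix y assume "y \<noteq> x"
    show "indicator ?E y \<le> ennreal (r powr (?n - \<alpha>) * t powr (- p)) * ?w y"
    proof (cases "y \<in> ?E")
      case True
      \<comment> \<open>The first bound uses \<alpha> < n: the exponent n - \<alpha> is positive, so
        the kernel is smallest near the boundary of the ball.\<close>
      then have "norm (x - y) powr (?n - \<alpha>) \<le> r powr (?n - \<alpha>)" "t powr p \<le> \<bar>f y\<bar> powr p"
        using assms by (auto simp: dist_norm intro!: powr_mono2)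
      then have "norm (x - y) powr (?n - \<alpha>) * t powr p \<le> r powr (?n - \<alpha>) * \<bar>f y\<bar> powr p"
        by (intro mult_mono) auto
      then have "1 \<le> r powr (?n - \<alpha>) * t powr (- p) * (\<bar>f y\<bar> powr p / norm (x - y) powr (?n - \<alpha>))"
        using \<open>y \<noteq> x\<close> \<open>0 < t\<close> by (simp add: powr_minus_divide field_simps)
      then show ?thesis
        using True by (simp add: ennreal_mult[symmetric])
    qed simp
  qed
  then have "(\<integral>\<^sup>+ y. indicator ?E y \<partial>lebesgue)
      \<le> (\<integral>\<^sup>+ y. ennreal (r powr (?n - \<alpha>) * t powr (- p)) * ?w y \<partial>lebesgue)"
    by (rule nn_integral_mono_AE)
  moreover have "?E \<in> sets lebesgue" by measurable
  moreover have "(\<integral>\<^sup>+ y. ennreal (r powr (?n - \<alpha>) * t powr (- p)) * ?w y \<partial>lebesgue)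
      = ennreal (r powr (?n - \<alpha>) * t powr (- p)) * (\<integral>\<^sup>+ y. ?w y \<partial>lebesgue)"
  proof (rule nn_integral_cmult)
    have "(\<lambda>y. norm (x - y)) \<in> borel_measurable borel" by measurable
    then have [measurable]: "(\<lambda>y. norm (x - y)) \<in> borel_measurable lebesgue"
      by (intro measurable_completion) simp
    show "?w \<in> borel_measurable lebesgue" by measurable
  qed
  ultimately have "emeasure lebesgue ?E \<le> ennreal (r powr (?n - \<alpha>) * t powr (- p)) * (\<integral>\<^sup>+ y. ?w y \<partial>lebesgue)"
    by (simp only: nn_integral_indicator)
  also have "(\<integral>\<^sup>+ y. ?w y \<partial>lebesgue) \<le> ennreal (s powr p)"
  proof (rule le_powr_if_ennpowr_le)
    \<comment> \<open>The centre of the ball is also the pole of the kernel, so this is the term for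
      x in the supremum defining the modulus.\<close>
    show "ennpowr (\<integral>\<^sup>+ y. ?w y \<partial>lebesgue) (1 / p) \<le> ennreal s"
      using le unfolding stummel_modulus_def by (simp add: SUP_le_iff)
  qed (use assms in auto)
  finally show ?thesis
    using assms by (simp add: ennreal_mult[symmetric] powr_divide powr_minus_divide mult_left_mono)
qed

text \<open>The level set bound is applied with s = c r^(\<sigma>/p) at the radius of the ball
  itself. The kernel contributes r^((n - \<alpha>)/p) and the modulus r^(\<sigma>/p); the Morrey
  exponent n - \<alpha> + \<sigma> is the one whose weight cancels this product, leaving the bound c
  for the norm.\<close>

lemma weak_morreyI_stummel_modulus:
  fixes f :: "real ^ 'n \<Rightarrow> real"
  assumes "f \<in> borel_measurable lebesgue" "0 < p" "\<alpha> < real CARD('n)" "0 \<le> c"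
    and le: "\<And>r. 0 < r \<Longrightarrow> stummel_modulus p \<alpha> f r \<le> ennreal (c * r powr (\<sigma> / p))"
  shows "f \<in> weak_morrey p (real CARD('n) - \<alpha> + \<sigma>)"
proof -
  let ?n = "real CARD('n)"
  have "ennreal (r powr (- ((?n - \<alpha> + \<sigma>) / p))) *
      (SUP t\<in>{0<..}. ennreal t * ennpowr (emeasure lebesgue {y \<in> ball x r. \<bar>f y\<bar> > t}) (1 / p))
      \<le> ennreal c" if "0 < r" for x :: "real ^ 'n" and r
  proof -
    have "ennreal t * ennpowr (emeasure lebesgue {y \<in> ball x r. \<bar>f y\<bar> > t}) (1 / p)
        \<le> ennreal (c * r powr ((?n - \<alpha> + \<sigma>) / p))" if "0 < t" for t
    proof -
      let ?s = "c * r powr (\<sigma> / p)"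
      have "ennpowr (emeasure lebesgue {y \<in> ball x r. \<bar>f y\<bar> > t}) (1 / p)
          \<le> ennpowr (ennreal (r powr (?n - \<alpha>) * (?s / t) powr p)) (1 / p)"
        using assms \<open>0 < r\<close> that by (intro ennpowr_mono stummel_level_set) auto
      also have "\<dots> = ennreal (r powr ((?n - \<alpha>) / p) * (?s / t))"
        using assms that by (simp add: ennpowr_ennreal powr_mult powr_powr powr_divide)
      finally have "ennreal t * ennpowr (emeasure lebesgue {y \<in> ball x r. \<bar>f y\<bar> > t}) (1 / p)
          \<le> ennreal t * ennreal (r powr ((?n - \<alpha>) / p) * (?s / t))"
        by (rule mult_left_mono) simp
      also have "\<dots> = ennreal (c * (r powr ((?n - \<alpha>) / p) * r powr (\<sigma> / p)))"
        using assms that by (simp add: ennreal_mult[symmetric] mult_ac)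
      finally show ?thesis
        by (simp add: powr_add[symmetric] add_divide_distrib)
    qed
    then have "ennreal (r powr (- ((?n - \<alpha> + \<sigma>) / p))) *
        (SUP t\<in>{0<..}. ennreal t * ennpowr (emeasure lebesgue {y \<in> ball x r. \<bar>f y\<bar> > t}) (1 / p))
        \<le> ennreal (r powr (- ((?n - \<alpha> + \<sigma>) / p))) * ennreal (c * r powr ((?n - \<alpha> + \<sigma>) / p))"
      by (intro mult_left_mono SUP_least) auto
    also have "\<dots> = ennreal c"
      using \<open>0 \<le> c\<close> \<open>0 < r\<close> by (simp add: ennreal_mult[symmetric] powr_minus_divide)
    finally show ?thesis .
  qed
  then have "weak_morrey_norm p (?n - \<alpha> + \<sigma>) f \<le> ennreal c"
    unfolding weak_morrey_norm_def by (intro SUP_least) auto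
  then show ?thesis
    using assms by (simp add: weak_morrey_def le_less_trans)
qed

theorem theorem4p10:
  shows "(\<forall>(p1::real) (p2::real) (lam::real) (\<alpha>::real).
            1 \<le> p2 \<and> p2 < p1 \<and> 0 \<le> lam \<and> lam < real CARD('n) \<and>
            (real CARD('n) - lam) * p2 / p1 < \<alpha> \<and> \<alpha> < real CARD('n) \<longrightarrow>
            (weak_morrey p1 lam :: (real ^ 'n \<Rightarrow> real) set) \<subseteq> stummel p2 \<alpha>) \<and>
         (\<forall>(p::real) (\<alpha>::real) (\<sigma>::real) (c::real) (f :: real ^ 'n \<Rightarrow> real).
            1 \<le> p \<and> 0 < \<alpha> \<and> \<alpha> < real CARD('n) \<and> f \<in> stummel p \<alpha> \<and>
            0 < \<sigma> \<and> 0 < c \<and>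
            (\<forall>r>0. stummel_modulus p \<alpha> f r \<le> ennreal (c * r powr (\<sigma> / p))) \<longrightarrow>
            f \<in> weak_morrey p (real CARD('n) - \<alpha> + \<sigma>))"
proof (intro conjI allI impI)
  fix p1 p2 lam \<alpha> :: real
  assume "1 \<le> p2 \<and> p2 < p1 \<and> 0 \<le> lam \<and> lam < real CARD('n) \<and>
    (real CARD('n) - lam) * p2 / p1 < \<alpha> \<and> \<alpha> < real CARD('n)"
  then show "(weak_morrey p1 lam :: (real ^ 'n \<Rightarrow> real) set) \<subseteq> stummel p2 \<alpha>"
    by (intro weak_morrey_subset_stummel) auto
next
  fix p \<alpha> \<sigma> c :: real and f :: "real ^ 'n \<Rightarrow> real"
  assume "1 \<le> p \<and> 0 < \<alpha> \<and> \<alpha> < real CARD('n) \<and> f \<in> stummel p \<alpha> \<and> 0 < \<sigma> \<and> 0 < c \<and>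
    (\<forall>r>0. stummel_modulus p \<alpha> f r \<le> ennreal (c * r powr (\<sigma> / p)))"
  then show "f \<in> weak_morrey p (real CARD('n) - \<alpha> + \<sigma>)"
    by (intro weak_morreyI_stummel_modulus[where c = c]) (auto simp: stummel_def Lp_loc_def)
qed

end
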